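(* Let $K$ be a finite simplicial complex. If $\dim K\leq 2$, then $s_2(K)\leq s_p(K)$ for any prime $p$.
   Context: For a prime $p$ and an integer $n\ge 0$, the universal simplicial complex $X(\mathbb{F}_p^n)$ is the abstract simplicial complex whose vertices are the nonzero vectors of $\mathbb{F}_p^n$ and whose simplices are the sets of vectors that are linearly independent over $\mathbb{F}_p$. A simplicial map is nondegenerate if it is injective on the vertex set of every simplex (equivalently, it maps every $j$-simplex onto a $j$-simplex). For a finite simplicial complex $\mathcal{K}$ with $m$ vertices and a prime $p$, the mod $p$ Buchstaber invariant of $\mathcal{K}$ is the integer $s_p(\mathcal{K})=m-r$, where $r$ is the least integer such that there is a nondegenerate simplicial map $\mathcal{K}\to X(\mathbb{F}_p^r)$. *)

theory Defs
  imports
    "HOL-Number_Theory.Residues"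
    "Jordan_Normal_Form.Missing_VectorSpace"
begin

text \<open>
  Convention: a nonempty abstract simplicial complex contains the empty simplex, which has
  dimension \<open>-1\<close>. The vertices are the points \<open>v\<close> with \<open>{v}\<close> a simplex; equivalently, those lying
  in some simplex.
\<close>

definition simplicial_cplx :: "'v set set \<Rightarrow> bool" where
  "simplicial_cplx K \<longleftrightarrow>
     {} \<in> K \<and> (\<forall>\<sigma>\<in>K. finite \<sigma>) \<and> (\<forall>\<sigma>\<in>K. \<forall>\<tau>. \<tau> \<subseteq> \<sigma> \<longrightarrow> \<tau> \<in> K)"

definition vertices :: "'v set set \<Rightarrow> 'v set" where
  "vertices K = {v. {v} \<in> K}"

definition finite_simplicial_cplx :: "'v set set \<Rightarrow> bool" where
  "finite_simplicial_cplx K \<longleftrightarrow> simplicial_cplx K \<and> finite (vertices K)"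

definition cplx_dim :: "'v set set \<Rightarrow> int" where
  "cplx_dim K = Max ((\<lambda>\<sigma>. int (card \<sigma>) - 1) ` K)"

text \<open>Only the values of \<open>f\<close> on the vertices of \<open>K\<close> matter.\<close>

definition simplicial_map :: "'v set set \<Rightarrow> 'w set set \<Rightarrow> ('v \<Rightarrow> 'w) \<Rightarrow> bool" where
  "simplicial_map K L f \<longleftrightarrow> f \<in> vertices K \<rightarrow> vertices L \<and> (\<forall>\<sigma>\<in>K. f ` \<sigma> \<in> L)"

definition nondegenerate_map :: "'v set set \<Rightarrow> 'w set set \<Rightarrow> ('v \<Rightarrow> 'w) \<Rightarrow> bool" where
  "nondegenerate_map K L f \<longleftrightarrow> simplicial_map K L f \<and> (\<forall>\<sigma>\<in>K. inj_on f \<sigma>)"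

text \<open>
  The module \<open>R\<^sup>n\<close>. Vectors are functions on \<open>{..<n}\<close> extended by \<^const>\<open>undefined\<close>. The
  multiplicative fields are inherited by the module record from rings and play no role in a module.
\<close>

definition coord_module :: "('a, 'r) ring_scheme \<Rightarrow> nat \<Rightarrow> ('a, nat \<Rightarrow> 'a) module" where
  "coord_module R n =
     \<lparr>carrier = {..<n} \<rightarrow>\<^sub>E carrier R,
      monoid.mult = undefined,
      one = undefined,
      zero = (\<lambda>i\<in>{..<n}. \<zero>\<^bsub>R\<^esub>),
      add = (\<lambda>u v. \<lambda>i\<in>{..<n}. u i \<oplus>\<^bsub>R\<^esub> v i),
      smult = (\<lambda>c v. \<lambda>i\<in>{..<n}. c \<otimes>\<^bsub>R\<^esub> v i)\<rparr>"

lemma module_coord_module: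
  assumes "cring R"
  shows "Module.module R (coord_module R n)"
proof -
  interpret cring R by fact
  have "abelian_group (coord_module R n)"
  proof (rule abelian_groupI, goal_cases)
    case (6 x)
    then show ?case
      by (intro bexI[of _ "\<lambda>i\<in>{..<n}. \<ominus>\<^bsub>R\<^esub> x i"])
        (auto simp: coord_module_def PiE_iff l_neg)
  qed (auto simp: coord_module_def PiE_iff a_ac extensional_def fun_eq_iff)
  then show ?thesis
    by (intro module.intro module_axioms.intro)
      (auto simp: coord_module_def PiE_iff is_cring l_distr r_distr m_assoc extensional_def fun_eq_iff)
qed

abbreviation Fp_space :: "nat \<Rightarrow> nat \<Rightarrow> (int, nat \<Rightarrow> int) module" where
  "Fp_space p n \<equiv> coord_module (residue_ring (int p)) n"

lemma vectorspace_Fp_space: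
  assumes "prime p"
  shows "vectorspace (residue_ring (int p)) (Fp_space p n)"
proof -
  have "Ring.field (residue_ring (int p))"
    using assms by (intro residues_prime.is_field residues_prime.intro)
  then show ?thesis
    by (simp add: vectorspace_def module_coord_module cring.axioms field.axioms fieldE(1))
qed

definition universal_cplx :: "nat \<Rightarrow> nat \<Rightarrow> (nat \<Rightarrow> int) set set" where
  "universal_cplx p n =
     {S. S \<subseteq> carrier (Fp_space p n) \<and>
         \<not> module.lin_dep (residue_ring (int p)) (Fp_space p n) S}"

definition buchstaber :: "nat \<Rightarrow> 'v set set \<Rightarrow> int" where
  "buchstaber p K =
     int (card (vertices K)) -
     int (LEAST r. \<exists>f. nondegenerate_map K (universal_cplx p r) f)"

end

theory Submission
  imports Defs
begin

text \<open>
  The invariant \<open>s\<^sub>p\<close> is the number of vertices minus the least rank \<open>r\<close> for which a nondegenerate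
  map into \<open>X(\<bbbF>\<^sub>p\<^sup>r)\<close> exists, so it suffices to turn every nondegenerate map into \<open>X(\<bbbF>\<^sub>2\<^sup>r)\<close> into one
  into \<open>X(\<bbbF>\<^sub>p\<^sup>r)\<close>. This is done by reading the coordinates \<open>0, 1\<close> of a vector over \<open>\<bbbF>\<^sub>2\<close> as elements of
  \<open>\<bbbF>\<^sub>p\<close>. As residues are represented by the integers \<open>0, \<dots>, p - 1\<close>, the lift is the identity, and
  the map need not be changed at all.

  The point is that at most three \<open>0/1\<close>-vectors that are independent modulo \<open>2\<close> remain independent
  modulo \<open>p\<close>, and simplices of a complex of dimension at most \<open>2\<close> have at most three vertices. One
  classical reason is that a \<open>3 \<times> 3\<close> matrix with entries \<open>0, 1\<close> has determinant of absolute value at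
  most \<open>2\<close>, so an odd minor is \<open>\<plusminus>1\<close>. The proof below avoids determinants: independence modulo
  \<open>2\<close> says that each nonempty subset of the vectors has an odd coordinate sum somewhere, and
  the resulting patterns of zeros and ones are enough to kill the coefficients of a linear relation
  modulo \<open>p\<close> one after the other (lemmas \<open>dvd_some_coeff\<close> and \<open>dvd_all_coeffs\<close>).

  The least rank over \<open>\<bbbF>\<^sub>2\<close> is a minimum over a nonempty set, because sending the vertices
  to distinct standard basis vectors is nondegenerate. So it is attained by some map, and this is the
  map that is reinterpreted over \<open>\<bbbF>\<^sub>p\<close>.
\<close>

section \<open>Linear independence as a divisibility condition\<close>

lemma lincomb_Fp_space:
  assumes "1 < p" "finite S" "S \<subseteq> carrier (Fp_space p n)"
    and "a \<in> S \<rightarrow> carrier (residue_ring (int p))"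
  shows "module.lincomb (Fp_space p n) a S = (\<lambda>i\<in>{..<n}. (\<Sum>v\<in>S. a v * v i) mod int p)"
proof -
  interpret residues "int p" "residue_ring (int p)"
    using assms(1) by (auto intro: residues.intro)
  interpret M: Module.module "residue_ring (int p)" "Fp_space p n"
    by (rule module_coord_module) (rule is_cring)
  have smult: "a v \<odot>\<^bsub>Fp_space p n\<^esub> v \<in> carrier (Fp_space p n)" if "v \<in> S" for v
    using that assms by (intro M.smult_closed) auto
  show ?thesis
    unfolding M.lincomb_def using assms(2) assms(3,4) smult
  proof (induction S rule: finite_induct)
    case empty
    have "\<zero>\<^bsub>Fp_space p n\<^esub> = (\<lambda>i\<in>{..<n}. 0)"
      by (simp add: coord_module_def res_zero_eq)
    then show ?case by simp
  next
    case (insert x S)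
    have "(\<Oplus>\<^bsub>Fp_space p n\<^esub>v\<in>insert x S. a v \<odot>\<^bsub>Fp_space p n\<^esub> v) =
        a x \<odot>\<^bsub>Fp_space p n\<^esub> x \<oplus>\<^bsub>Fp_space p n\<^esub> (\<Oplus>\<^bsub>Fp_space p n\<^esub>v\<in>S. a v \<odot>\<^bsub>Fp_space p n\<^esub> v)"
      using insert by (intro M.finsum_insert) auto
    also have "\<dots> = a x \<odot>\<^bsub>Fp_space p n\<^esub> x \<oplus>\<^bsub>Fp_space p n\<^esub>
        (\<lambda>i\<in>{..<n}. (\<Sum>v\<in>S. a v * v i) mod int p)"
      using insert by (subst insert.IH) auto
    also have "\<dots> = (\<lambda>i\<in>{..<n}. (\<Sum>v\<in>insert x S. a v * v i) mod int p)"
      using insert.hyps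
      by (auto simp: coord_module_def res_add_eq res_mult_eq fun_eq_iff mod_simps)
    finally show ?case .
  qed
qed

text \<open>
  The coefficients \<open>a\<close> range over all integers: reducing them modulo \<open>p\<close> gives elements of the
  residue ring and changes neither side of the implication.
\<close>

lemma universal_cplx_iff:
  assumes "1 < p" "finite S"
  shows "S \<in> universal_cplx p n \<longleftrightarrow>
    S \<subseteq> carrier (Fp_space p n) \<and>
    (\<forall>a. (\<forall>i<n. int p dvd (\<Sum>v\<in>S. a v * v i)) \<longrightarrow> (\<forall>v\<in>S. int p dvd a v))"
proof (cases "S \<subseteq> carrier (Fp_space p n)")
  case True
  interpret residues "int p" "residue_ring (int p)"
    using assms(1) by (auto intro: residues.intro)
  interpret M: Module.module "residue_ring (int p)" "Fp_space p n"
    by (rule module_coord_module) (rule is_cring)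
  have lincomb_zero: "M.lincomb a S = \<zero>\<^bsub>Fp_space p n\<^esub> \<longleftrightarrow> (\<forall>i<n. int p dvd (\<Sum>v\<in>S. a v * v i))"
    if "a \<in> S \<rightarrow> carrier (residue_ring (int p))" for a
    unfolding lincomb_Fp_space[OF assms True that]
    by (auto simp: coord_module_def res_zero_eq fun_eq_iff dvd_eq_mod_eq_0 restrict_def)
  have reduce: "(\<lambda>v. a v mod int p) \<in> S \<rightarrow> carrier (residue_ring (int p))" for a
    using assms(1) by (auto simp: res_carrier_eq)
  have reduce_dvd: "int p dvd (\<Sum>v\<in>S. a v mod int p * v i) \<longleftrightarrow> int p dvd (\<Sum>v\<in>S. a v * v i)"
    for a :: "(nat \<Rightarrow> int) \<Rightarrow> int" and i
  proof -
    have "(\<Sum>v\<in>S. a v mod int p * v i) mod int p = (\<Sum>v\<in>S. a v * v i) mod int p"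
      by (subst (1 2) mod_sum_eq[symmetric]) (simp add: mod_simps)
    then show ?thesis
      by (simp add: dvd_eq_mod_eq_0)
  qed
  show ?thesis
  proof
    assume "S \<in> universal_cplx p n"
    then have indpt: "M.lin_indpt S"
      by (simp add: universal_cplx_def)
    have "int p dvd a v" if rel: "\<forall>i<n. int p dvd (\<Sum>v\<in>S. a v * v i)" and "v \<in> S" for a v
    proof (rule ccontr)
      assume "\<not> int p dvd a v"
      then have "a v mod int p \<noteq> \<zero>\<^bsub>residue_ring (int p)\<^esub>"
        by (simp add: res_zero_eq dvd_eq_mod_eq_0)
      moreover have "M.lincomb (\<lambda>v. a v mod int p) S = \<zero>\<^bsub>Fp_space p n\<^esub>"
        using rel by (simp add: lincomb_zero[OF reduce] reduce_dvd)
      ultimately show False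
        using indpt M.lin_dep_crit[OF assms(2) subset_refl reduce \<open>v \<in> S\<close>] by blast
    qed
    then show "S \<subseteq> carrier (Fp_space p n) \<and>
        (\<forall>a. (\<forall>i<n. int p dvd (\<Sum>v\<in>S. a v * v i)) \<longrightarrow> (\<forall>v\<in>S. int p dvd a v))"
      using True by blast
  next
    assume R: "S \<subseteq> carrier (Fp_space p n) \<and>
        (\<forall>a. (\<forall>i<n. int p dvd (\<Sum>v\<in>S. a v * v i)) \<longrightarrow> (\<forall>v\<in>S. int p dvd a v))"
    have "M.lin_indpt S"
    proof (rule M.finite_lin_indpt2[OF assms(2) True])
      fix a
      assume a: "a \<in> S \<rightarrow> carrier (residue_ring (int p))"
        and "M.lincomb a S = \<zero>\<^bsub>Fp_space p n\<^esub>"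
      then have dvd: "int p dvd a v" if "v \<in> S" for v
        using R lincomb_zero[OF a] that by blast
      show "\<forall>v\<in>S. a v = \<zero>\<^bsub>residue_ring (int p)\<^esub>"
      proof
        fix v
        assume "v \<in> S"
        then have "0 \<le> a v" "a v < int p"
          using a by (auto simp: res_carrier_eq)
        then show "a v = \<zero>\<^bsub>residue_ring (int p)\<^esub>"
          using dvd[OF \<open>v \<in> S\<close>] by (simp add: res_zero_eq dvd_eq_mod_eq_0)
      qed
    qed
    then show "S \<in> universal_cplx p n"
      using True by (simp add: universal_cplx_def)
  qed
qed (simp add: universal_cplx_def)

section \<open>Zero-one vectors that are independent modulo two\<close>

text \<open>
  Over \<open>\<bbbF>\<^sub>2\<close> a linear relation is a subset with vanishing sum; the witness is the indicator function
  of \<open>T\<close>, taken as the family of coefficients.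
\<close>

lemma odd_coordinate_sum:
  assumes "S \<in> universal_cplx 2 n" "finite S" "T \<subseteq> S" "T \<noteq> {}"
  shows "\<exists>i<n. odd (\<Sum>v\<in>T. v i)"
proof (rule ccontr)
  assume "\<not> ?thesis"
  moreover have "(\<Sum>v\<in>S. of_bool (v \<in> T) * v i) = (\<Sum>v\<in>T. v i)" for i
    using assms(2,3) by (intro sum.mono_neutral_cong_right) auto
  ultimately have "\<forall>i<n. int 2 dvd (\<Sum>v\<in>S. of_bool (v \<in> T) * v i)"
    by (simp del: sum_of_bool_mult_eq)
  moreover have "(\<forall>i<n. int 2 dvd (\<Sum>v\<in>S. a v * v i)) \<longrightarrow> (\<forall>v\<in>S. int 2 dvd a v)" for a
    using assms(1,2) universal_cplx_iff[of 2 S n] by simp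
  note this[of "\<lambda>v. of_bool (v \<in> T)"]
  ultimately have "\<forall>v\<in>S. int 2 dvd of_bool (v \<in> T)"
    by blast
  moreover obtain v where "v \<in> T"
    using assms(4) by blast
  ultimately have "int 2 dvd of_bool (v \<in> T)"
    using assms(3) by blast
  then show False
    using \<open>v \<in> T\<close> by simp
qed

text \<open>
  Choose a coordinate at which the sum over all of \<open>S\<close> is odd. An odd number of the vectors, one or
  three, are \<open>1\<close> there. If it is one vector, the relation at this coordinate is the claim for its
  coefficient. If it is three, the coefficients of \<open>S = {u, v, w}\<close> add up to zero modulo \<open>m\<close>; at a coordinate where
  exactly one of \<open>u, v\<close> is \<open>1\<close>, the relation either isolates a coefficient or pairs it with that of
  \<open>w\<close>, and subtracting the latter from the total sum isolates the third coefficient.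
\<close>

lemma dvd_some_coeff:
  fixes S :: "('i \<Rightarrow> int) set" and m :: int
  assumes "finite S" "S \<noteq> {}" "card S \<le> 3"
    and zero_one: "\<And>v i. v \<in> S \<Longrightarrow> i \<in> I \<Longrightarrow> v i \<in> {0, 1}"
    and odd: "\<And>T. T \<subseteq> S \<Longrightarrow> T \<noteq> {} \<Longrightarrow> \<exists>i\<in>I. odd (\<Sum>v\<in>T. v i)"
    and rel: "\<And>i. i \<in> I \<Longrightarrow> m dvd (\<Sum>v\<in>S. a v * v i)"
  shows "\<exists>v\<in>S. m dvd a v"
proof -
  obtain i where i: "i \<in> I" "odd (\<Sum>v\<in>S. v i)"
    using odd[of S] assms(2) by blast
  define T where "T = {v \<in> S. v i = 1}"
  have "finite T" "T \<subseteq> S"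
    using assms(1) by (auto simp: T_def)
  have "(\<Sum>v\<in>S. v i) = (\<Sum>v\<in>T. 1)"
    using assms(1) zero_one i(1) by (intro sum.mono_neutral_cong_right) (auto simp: T_def)
  then have "odd (card T)"
    using i(2) by simp
  have "(\<Sum>v\<in>S. a v * v i) = (\<Sum>v\<in>T. a v)"
    using assms(1) zero_one i(1) by (intro sum.mono_neutral_cong_right) (auto simp: T_def)
  then have T_dvd: "m dvd (\<Sum>v\<in>T. a v)"
    using rel[OF i(1)] by simp
  have "card T \<le> 3"
    using card_mono[OF assms(1) \<open>T \<subseteq> S\<close>] assms(3) by simp
  then have "card T \<in> {0, 1, 2, 3}"
    by auto
  then consider "card T = 1" | "card T = 3"
    using \<open>odd (card T)\<close> by auto
  then show ?thesis
  proof cases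
    case 1
    then obtain v where "T = {v}"
      by (auto simp: card_1_singleton_iff)
    then show ?thesis
      using T_dvd \<open>T \<subseteq> S\<close> by auto
  next
    case 2
    then have "T = S"
      using card_seteq[OF assms(1) \<open>T \<subseteq> S\<close>] assms(3) by simp
    with 2 obtain u v w where S: "S = {u, v, w}" and ne: "u \<noteq> v" "u \<noteq> w" "v \<noteq> w"
      by (auto simp: card_3_iff)
    have total: "m dvd a u + a v + a w"
      using T_dvd ne by (simp add: \<open>T = S\<close> S add.assoc)
    obtain j where j: "j \<in> I" "odd (\<Sum>x\<in>{u, v}. x j)"
      using odd[of "{u, v}"] S by blast
    have val: "u j \<in> {0, 1}" "v j \<in> {0, 1}" "w j \<in> {0, 1}"
      using zero_one[OF _ j(1)] S by auto
    have rel_j: "m dvd a u * u j + a v * v j + a w * w j"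
      using rel[OF j(1)] ne by (simp add: S add.assoc)
    have uv: "odd (u j + v j)"
      using j(2) ne by simp
    consider "u j = 1" "v j = 0" "w j = 0" | "u j = 1" "v j = 0" "w j = 1"
      | "u j = 0" "v j = 1" "w j = 0" | "u j = 0" "v j = 1" "w j = 1"
      using val uv by auto
    then show ?thesis
    proof cases
      case 2
      then have "m dvd (a u + a v + a w) - (a u + a w)"
        using rel_j total by (intro dvd_diff) auto
      then show ?thesis
        by (auto simp: S)
    next
      case 4
      then have "m dvd (a u + a v + a w) - (a v + a w)"
        using rel_j total by (intro dvd_diff) auto
      then show ?thesis
        by (auto simp: S)
    qed (use rel_j in \<open>auto simp: S\<close>)
  qed
qed

text \<open>
  A vector whose coefficient is divisible by \<open>m\<close> can be dropped from the relation, and the parity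
  condition passes to subsets, so the previous lemma applies again to the remaining vectors.
\<close>

lemma dvd_all_coeffs:
  fixes S :: "('i \<Rightarrow> int) set" and m :: int
  assumes "finite S" "card S \<le> 3"
    and "\<And>v i. v \<in> S \<Longrightarrow> i \<in> I \<Longrightarrow> v i \<in> {0, 1}"
    and "\<And>T. T \<subseteq> S \<Longrightarrow> T \<noteq> {} \<Longrightarrow> \<exists>i\<in>I. odd (\<Sum>v\<in>T. v i)"
    and "\<And>i. i \<in> I \<Longrightarrow> m dvd (\<Sum>v\<in>S. a v * v i)"
  shows "\<forall>v\<in>S. m dvd a v"
  using assms
proof (induction S rule: finite_psubset_induct)
  case (psubset S)
  show ?case
  proof (cases "S = {}")
    case False
    obtain x where x: "x \<in> S" "m dvd a x"
      using dvd_some_coeff[OF psubset.hyps False, of I m a] psubset.prems by blast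
    have "\<forall>v\<in>S - {x}. m dvd a v"
    proof (rule psubset.IH)
      show "S - {x} \<subset> S"
        using x by blast
      show "card (S - {x}) \<le> 3"
        using psubset.prems(1) card_Diff1_le[of S x] by linarith
      show "\<exists>i\<in>I. odd (\<Sum>v\<in>T. v i)" if "T \<subseteq> S - {x}" "T \<noteq> {}" for T
        using psubset.prems(3)[of T] that by blast
      show "m dvd (\<Sum>v\<in>S - {x}. a v * v i)" if "i \<in> I" for i
        using psubset.prems(4)[OF that] x
        by (simp add: sum.remove[OF psubset.hyps x(1)] dvd_add_right_iff)
    qed (use psubset.prems(2) in auto)
    then show ?thesis
      using x by blast
  qed simp
qed

lemma universal_cplx_2_imp_universal_cplx:
  assumes "1 < p" "finite S" "card S \<le> 3" "S \<in> universal_cplx 2 n"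
  shows "S \<in> universal_cplx p n"
proof -
  interpret F2: residues "int 2" "residue_ring (int 2)"
    by (rule residues.intro) auto
  interpret Fp: residues "int p" "residue_ring (int p)"
    using assms(1) by (auto intro: residues.intro)
  have S: "S \<subseteq> {..<n} \<rightarrow>\<^sub>E {0..1}"
    using assms(4) F2.res_carrier_eq by (simp add: universal_cplx_def coord_module_def)
  have "v i \<in> {0, 1}" if "v \<in> S" "i \<in> {..<n}" for v i
  proof -
    have "v i \<in> {0..1}"
      using S that by blast
    then show ?thesis by auto
  qed
  moreover have "\<exists>i\<in>{..<n}. odd (\<Sum>v\<in>T. v i)" if "T \<subseteq> S" "T \<noteq> {}" for T
    using odd_coordinate_sum[OF assms(4,2) that] by auto
  ultimately have
    "(\<forall>i<n. int p dvd (\<Sum>v\<in>S. a v * v i)) \<longrightarrow> (\<forall>v\<in>S. int p dvd a v)" for a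
    using dvd_all_coeffs[OF assms(2,3), where I = "{..<n}" and a = a] by blast
  moreover have "{..<n} \<rightarrow>\<^sub>E {0..1} \<subseteq> carrier (Fp_space p n)"
    using assms(1) by (auto simp: coord_module_def Fp.res_carrier_eq intro!: PiE_mono)
  ultimately show ?thesis
    using S universal_cplx_iff[OF assms(1,2)] by blast
qed

section \<open>Nondegenerate maps into universal complexes\<close>

lemma subset_vertices:
  assumes "simplicial_cplx K" "\<sigma> \<in> K"
  shows "\<sigma> \<subseteq> vertices K"
  using assms by (auto simp: simplicial_cplx_def vertices_def)

text \<open>
  A vertex \<open>v\<close> of \<open>K\<close> spans the simplex \<open>{v}\<close>, whose image has to be a simplex as well. So vertices are
  mapped to vertices as soon as simplices are mapped to simplices.
\<close>

lemma nondegenerate_map_iff: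
  "nondegenerate_map K L f \<longleftrightarrow> (\<forall>\<sigma>\<in>K. f ` \<sigma> \<in> L \<and> inj_on f \<sigma>)"
  by (fastforce simp: nondegenerate_map_def simplicial_map_def vertices_def)

lemma card_simplex_le:
  assumes "finite_simplicial_cplx K" "\<sigma> \<in> K"
  shows "int (card \<sigma>) \<le> cplx_dim K + 1"
proof -
  have "K \<subseteq> Pow (vertices K)"
    using assms subset_vertices by (auto simp: finite_simplicial_cplx_def)
  then have "finite K"
    using assms(1) by (auto simp: finite_simplicial_cplx_def intro: finite_subset)
  then have "int (card \<sigma>) - 1 \<le> cplx_dim K"
    unfolding cplx_dim_def using assms(2) by (intro Max_ge) auto
  then show ?thesis by simp
qed

text \<open>
  Number the vertices and send the \<open>j\<close>-th one to the \<open>j\<close>-th standard basis vector: every set of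
  standard basis vectors is independent, since the coordinate \<open>j\<close> of a linear combination is the
  coefficient of the \<open>j\<close>-th of them.
\<close>

lemma ex_nondegenerate_map:
  assumes "finite_simplicial_cplx K" "1 < p"
  shows "\<exists>f. nondegenerate_map K (universal_cplx p (card (vertices K))) f"
proof -
  interpret residues "int p" "residue_ring (int p)"
    using assms(2) by (auto intro: residues.intro)
  define n where "n = card (vertices K)"
  obtain h where h: "bij_betw h (vertices K) {..<n}"
    using assms(1) ex_bij_betw_finite_nat[of "vertices K"]
    by (auto simp: n_def finite_simplicial_cplx_def atLeast0LessThan)
  define e where "e = (\<lambda>j. \<lambda>i\<in>{..<n}. of_bool (i = j) :: int)"
  have e_carrier: "e j \<in> carrier (Fp_space p n)" for j
    using assms(2) by (auto simp: e_def coord_module_def res_carrier_eq)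
  have inj_e: "inj_on e {..<n}"
  proof (rule inj_onI)
    fix j k
    assume "j \<in> {..<n}" "k \<in> {..<n}" "e j = e k"
    then have "e j j = e k j" by simp
    then show "j = k"
      using \<open>j \<in> {..<n}\<close> by (simp add: e_def split: if_splits)
  qed
  have indpt: "e ` J \<in> universal_cplx p n" if "J \<subseteq> {..<n}" for J
  proof -
    have "finite J"
      using that finite_subset by blast
    have "int p dvd a (e j)" if rel: "\<forall>i<n. int p dvd (\<Sum>v\<in>e ` J. a v * v i)" and "j \<in> J" for a j
    proof -
      have "j < n"
        using \<open>j \<in> J\<close> \<open>J \<subseteq> {..<n}\<close> by blast
      have "(\<Sum>v\<in>e ` J. a v * v j) = (\<Sum>k\<in>J. a (e k) * e k j)"
        using sum.reindex[OF inj_on_subset[OF inj_e \<open>J \<subseteq> {..<n}\<close>]] by simp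
      also have "\<dots> = (\<Sum>k\<in>J. if j = k then a (e k) else 0)"
        using \<open>j < n\<close> by (intro sum.cong) (auto simp: e_def)
      also have "\<dots> = a (e j)"
        using \<open>finite J\<close> \<open>j \<in> J\<close> by simp
      finally show ?thesis
        using rel \<open>j < n\<close> by metis
    qed
    then show ?thesis
      using \<open>finite J\<close> e_carrier universal_cplx_iff[OF assms(2), of "e ` J" n] by blast
  qed
  have "nondegenerate_map K (universal_cplx p n) (e \<circ> h)"
    unfolding nondegenerate_map_iff
  proof
    fix \<sigma>
    assume "\<sigma> \<in> K"
    then have \<sigma>: "\<sigma> \<subseteq> vertices K"
      using assms(1) subset_vertices by (auto simp: finite_simplicial_cplx_def)
    then have "h ` \<sigma> \<subseteq> {..<n}"
      using h by (auto simp: bij_betw_def)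
    moreover have "inj_on h \<sigma>"
      using h \<sigma> by (auto simp: bij_betw_def intro: inj_on_subset)
    ultimately show "(e \<circ> h) ` \<sigma> \<in> universal_cplx p n \<and> inj_on (e \<circ> h) \<sigma>"
      using indpt inj_e by (metis comp_inj_on image_comp inj_on_subset)
  qed
  then show ?thesis
    by (auto simp: n_def)
qed

theorem proposition4p12:
  fixes K :: "'v set set" and p :: nat
  assumes "finite_simplicial_cplx K"
    and "cplx_dim K \<le> 2"
    and "prime p"
  shows "buchstaber 2 K \<le> buchstaber p K"
proof -
  have "1 < p"
    using assms(3) prime_gt_1_nat by blast
  define r where "r = (LEAST r. \<exists>f. nondegenerate_map K (universal_cplx 2 r) f)"
  have "\<exists>f. nondegenerate_map K (universal_cplx 2 r) f"
    unfolding r_def by (rule LeastI) (rule ex_nondegenerate_map[OF assms(1)], simp)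
  then obtain f where f: "nondegenerate_map K (universal_cplx 2 r) f"
    by blast
  have "nondegenerate_map K (universal_cplx p r) f"
    unfolding nondegenerate_map_iff
  proof
    fix \<sigma>
    assume "\<sigma> \<in> K"
    then have "finite \<sigma>"
      using assms(1) by (auto simp: finite_simplicial_cplx_def simplicial_cplx_def)
    moreover have "card \<sigma> \<le> 3"
      using card_simplex_le[OF assms(1) \<open>\<sigma> \<in> K\<close>] assms(2) by linarith
    then have "card (f ` \<sigma>) \<le> 3"
      using card_image_le[OF \<open>finite \<sigma>\<close>, of f] by linarith
    ultimately show "f ` \<sigma> \<in> universal_cplx p r \<and> inj_on f \<sigma>"
      using f \<open>\<sigma> \<in> K\<close> \<open>1 < p\<close> by (auto simp: nondegenerate_map_iff intro: universal_cplx_2_imp_universal_cplx)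
  qed
  then have "(LEAST r. \<exists>f. nondegenerate_map K (universal_cplx p r) f) \<le> r"
    by (intro Least_le) blast
  then show ?thesis
    by (simp add: buchstaber_def r_def)
qed

end
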